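(* Let $S$ be an $\mathrm{Lsc}$-like $\mathrm{Cu}$-semigroup with least order unit $e$. Let $X_S=\{x\in S: x<e\text{ maximal}\}$ and, for $y\leq e$, let $C_y=\{x\in X_S: x\geq y\}$. Then $\{X_S\setminus C_y : y\leq e\}$ is a $T_1$-topology for $X_S$.
   Context: Cu-semigroups. In a partially ordered set, $x\ll y$ ($x$ is way-below $y$) means: for every increasing sequence $(z_n)_n$ whose supremum exists and is $\geq y$, there is $n$ with $x\leq z_n$. A $\mathrm{Cu}$-semigroup is a positively ordered (commutative) monoid $S$ (partial order compatible with addition, $0\leq x$ for all $x$) such that: (O1) increasing sequences have suprema; (O2) every element is the supremum of an $\ll$-increasing sequence; (O3) $x'\ll x$ and $y'\ll y$ imply $x'+y'\ll x+y$; (O4) $\sup_n x_n+\sup_n y_n=\sup_n(x_n+y_n)$ for increasing sequences. Write $\infty y=\sup_n ny$. An order unit is an element $u$ with $x\leq\infty u$ for all $x\in S$. Lsc-like. $S$ is distributively lattice ordered if it is a distributive lattice and $x+y=(x\vee y)+(x\wedge y)$ for all $x,y$; it is complete if suprema of arbitrary subsets exist. If $S$ has a greatest element it is denoted $\infty$. A subset $H\subseteq S$ is topological if for any two finite increasing sequences $(x_i)_{i=1}^m,(y_i)_{i=1}^m$ in $H$ one has $\sum_i x_i\leq\sum_i y_i$ iff $x_i\leq y_i$ for every $i$. Let $\downarrow e=\{s\in S: s\leq e\}$. $S$ is $\mathrm{Lsc}$-like if it is a complete distributively lattice ordered $\mathrm{Cu}$-semigroup such that: (C1) for all idempotents $y,z$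 (elements with $y+y=y$, $z+z=z$), $y\geq z$ iff $\{x<\infty: x$ maximal idempotent, $x\geq y\}\subseteq\{x<\infty: x$ maximal idempotent, $x\geq z\}$, where "$x<\infty$ maximal idempotent" means maximal among idempotents different from $\infty$; (C2) there is a topological subset of the form $\downarrow e$ such that the finite sums of elements of $\downarrow e$ are sup-dense in $S$ (every element of $S$ is the supremum of an increasing sequence of such sums). The element $e$ in (C2) is then the least order unit of $S$, so it is unique. "$x<e$ maximal" means maximal among the elements of $S$ strictly below $e$. *)

theory Defs
  imports "HOL-Analysis.Analysis" "HOL-Library.Lub_Glb"
begin

definition way_below :: "'a::order \<Rightarrow> 'a \<Rightarrow> bool" where
  "way_below x y \<longleftrightarrow>
     (\<forall>z s. incseq z \<longrightarrow> isLub UNIV (range z) s \<longrightarrow> y \<le> s \<longrightarrow> (\<exists>n::nat. x \<le> z n))"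

text \<open>A Cu-semigroup is a whole type, with its structure given by type classes.  The
  class \<open>canonically_ordered_monoid_add\<close> is deliberately not used: it would force the
  algebraic order, whereas the order of a Cu-semigroup is only required to be compatible with
  addition and positive.\<close>

definition cu_semigroup :: "'a::ordered_comm_monoid_add itself \<Rightarrow> bool" where
  "cu_semigroup (S :: 'a itself) \<longleftrightarrow>
     (\<forall>x::'a. 0 \<le> x) \<and>
     (\<forall>z :: nat \<Rightarrow> 'a. incseq z \<longrightarrow> (\<exists>s. isLub UNIV (range z) s)) \<and>
     (\<forall>x::'a. \<exists>z :: nat \<Rightarrow> 'a. (\<forall>n. way_below (z n) (z (Suc n))) \<and> isLub UNIV (range z) x) \<and>
     (\<forall>x' x y' y :: 'a. way_below x' x \<longrightarrow> way_below y' y \<longrightarrow> way_below (x' + y') (x + y)) \<and>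
     (\<forall>(u :: nat \<Rightarrow> 'a) v a b. incseq u \<longrightarrow> incseq v \<longrightarrow>
        isLub UNIV (range u) a \<longrightarrow> isLub UNIV (range v) b \<longrightarrow>
        isLub UNIV (range (\<lambda>n. u n + v n)) (a + b))"

definition infinite_multiple :: "'a::ordered_comm_monoid_add \<Rightarrow> 'a" where
  "infinite_multiple y = (THE s. isLub UNIV (range (\<lambda>n::nat. \<Sum>i<n. y)) s)"

text \<open>In a Cu-semigroup the description above denotes, i.e. the supremum exists.\<close>

lemma isLub_infinite_multiple:
  fixes y :: "'a::ordered_comm_monoid_add"
  assumes "cu_semigroup TYPE('a)"
  shows "isLub UNIV (range (\<lambda>n::nat. \<Sum>i<n. y)) (infinite_multiple y)"
proof -
  have pos: "0 \<le> y"
    and O1: "\<And>z :: nat \<Rightarrow> 'a. incseq z \<Longrightarrow> \<exists>s. isLub UNIV (range z) s"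
    using assms unfolding cu_semigroup_def by blast+
  have "incseq (\<lambda>n::nat. \<Sum>i<n. y)"
  proof (rule incseq_SucI)
    show "(\<Sum>i<n. y) \<le> (\<Sum>i<Suc n. y)" for n :: nat
      using add_left_mono[OF pos, of "\<Sum>i<n. y"] by simp
  qed
  then obtain s where s: "isLub UNIV (range (\<lambda>n::nat. \<Sum>i<n. y)) s"
    using O1 by blast
  moreover have "t = s" if "isLub UNIV (range (\<lambda>n::nat. \<Sum>i<n. y)) t" for t
    using that s by (meson antisym isLub_le_isUb isLub_isUb)
  ultimately show ?thesis
    unfolding infinite_multiple_def by (rule theI)
qed

definition order_unit :: "'a::ordered_comm_monoid_add \<Rightarrow> bool" where
  "order_unit u \<longleftrightarrow> (\<forall>x. x \<le> infinite_multiple u)"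

definition least_order_unit :: "'a::ordered_comm_monoid_add \<Rightarrow> bool" where
  "least_order_unit e \<longleftrightarrow> order_unit e \<and> (\<forall>u. order_unit u \<longrightarrow> e \<le> u)"

definition idempotent_elt :: "'a::comm_monoid_add \<Rightarrow> bool" where
  "idempotent_elt x \<longleftrightarrow> x + x = x"

definition maximal_idempotent :: "'a::{comm_monoid_add, order_top} \<Rightarrow> bool" where
  "maximal_idempotent x \<longleftrightarrow> idempotent_elt x \<and> x \<noteq> top \<and>
     (\<forall>w. idempotent_elt w \<longrightarrow> w \<noteq> top \<longrightarrow> x \<le> w \<longrightarrow> w = x)"

definition topological_subset :: "'a::{comm_monoid_add, order} set \<Rightarrow> bool" where
  "topological_subset H \<longleftrightarrow>
     (\<forall>(m::nat) x y. x ` {1..m} \<subseteq> H \<longrightarrow> y ` {1..m} \<subseteq> H \<longrightarrow>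
        mono_on {1..m} x \<longrightarrow> mono_on {1..m} y \<longrightarrow>
        ((\<Sum>i=1..m. x i) \<le> (\<Sum>i=1..m. y i) \<longleftrightarrow> (\<forall>i\<in>{1..m}. x i \<le> y i)))"

definition finite_sums :: "'a::comm_monoid_add set \<Rightarrow> 'a set" where
  "finite_sums H = {(\<Sum>i=1..m. x i) | (m::nat) x. x ` {1..m} \<subseteq> H}"

definition sup_dense :: "'a::order set \<Rightarrow> bool" where
  "sup_dense D \<longleftrightarrow>
     (\<forall>x. \<exists>z :: nat \<Rightarrow> 'a. incseq z \<and> range z \<subseteq> D \<and> isLub UNIV (range z) x)"

text \<open>Completeness asks for arbitrary suprema only; infima, \<open>bot\<close> and \<open>top\<close> are then determined
  by the order, so the class \<open>complete_lattice\<close> adds nothing. No infinite distributive law is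
  assumed.\<close>

definition lsc_like ::
    "'a::{ordered_comm_monoid_add, complete_lattice, distrib_lattice} itself \<Rightarrow> bool" where
  "lsc_like (S :: 'a itself) \<longleftrightarrow>
     cu_semigroup TYPE('a) \<and>
     (\<forall>x y :: 'a. x + y = sup x y + inf x y) \<and>
     (\<forall>y z :: 'a. idempotent_elt y \<longrightarrow> idempotent_elt z \<longrightarrow>
        (z \<le> y \<longleftrightarrow>
          {x. maximal_idempotent x \<and> y \<le> x} \<subseteq> {x. maximal_idempotent x \<and> z \<le> x})) \<and>
     (\<exists>e :: 'a. topological_subset {..e} \<and> sup_dense (finite_sums {..e}))"

definition maximal_below :: "'a::order \<Rightarrow> 'a set" where
  "maximal_below e = {x. x < e \<and> (\<forall>w. w < e \<longrightarrow> x \<le> w \<longrightarrow> w = x)}"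

definition closed_part :: "'a::order \<Rightarrow> 'a \<Rightarrow> 'a set" where
  "closed_part e y = {x \<in> maximal_below e. y \<le> x}"

end

theory Submission
  imports Defs
begin

text \<open>For a maximal \<open>x < e\<close> and \<open>y \<le> e\<close>, failing \<open>y \<le> x\<close> means \<open>sup y x = e\<close>; with distributivity this
  makes every such \<open>x\<close> prime, so that \<open>y \<mapsto> C\<^sub>y\<close> turns binary meets into unions, as it turns
  arbitrary joins into intersections.  Points are closed because \<open>C\<^sub>x = {x}\<close>.\<close>

text \<open>The join lies between \<open>x\<close> and \<open>e\<close>, so maximality leaves only
  these two values, and the value \<open>x\<close> would force \<open>y \<le> x\<close>.\<close>

lemma maximal_below_sup:
  fixes x y e :: "'a::lattice"
  assumes "x \<in> maximal_below e" "y \<le> e" "\<not> y \<le> x"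
  shows "sup y x = e"
proof (rule ccontr)
  assume "sup y x \<noteq> e"
  moreover have "sup y x \<le> e"
    using assms by (simp add: maximal_below_def less_imp_le)
  ultimately have "sup y x < e"
    by (simp add: less_le)
  then have "sup y x = x"
    using assms(1) by (simp add: maximal_below_def)
  with \<open>\<not> y \<le> x\<close> show False
    by (metis sup.cobounded1)
qed

lemma maximal_below_prime:
  fixes x y z e :: "'a::distrib_lattice"
  assumes x: "x \<in> maximal_below e" and "y \<le> e" "z \<le> e"
  shows "inf y z \<le> x \<longleftrightarrow> y \<le> x \<or> z \<le> x"
proof
  assume le: "inf y z \<le> x"
  show "y \<le> x \<or> z \<le> x"
  proof (rule ccontr)
    assume "\<not> (y \<le> x \<or> z \<le> x)"
    then have "sup y x = e" "sup z x = e"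
      using maximal_below_sup assms by blast+
    \<comment> \<open>Distributivity turns the left side into
      \<open>inf (sup y x) (sup z x)\<close>, that is \<open>inf e e\<close>.\<close>
    then have "sup (inf y z) x = e"
      by (simp add: sup_inf_distrib2)
    moreover have "sup (inf y z) x = x"
      using le by (rule sup_absorb2)
    ultimately show False
      using x by (simp add: maximal_below_def)
  qed
qed (auto intro: le_infI1 le_infI2)

lemma closed_part_inf:
  fixes y z e :: "'a::distrib_lattice"
  assumes "y \<le> e" "z \<le> e"
  shows "closed_part e (inf y z) = closed_part e y \<union> closed_part e z"
  using maximal_below_prime[OF _ assms] by (auto simp: closed_part_def)

text \<open>An element bounds \<open>Sup A\<close> iff it bounds every member of \<open>A\<close>;
  complements turn this intersection of closed sets into a union. An empty \<open>A\<close> yields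
  the empty set.\<close>

lemma closed_part_Sup:
  fixes e :: "'a::complete_lattice"
  shows "maximal_below e - closed_part e (Sup A) = (\<Union>y\<in>A. maximal_below e - closed_part e y)"
  by (auto simp: closed_part_def Sup_le_iff)

lemma closed_part_self: "closed_part e e = {}"
  by (auto simp: closed_part_def maximal_below_def)

text \<open>Distinct maximal elements are incomparable.\<close>

lemma closed_part_maximal_below:
  assumes "x \<in> maximal_below e"
  shows "closed_part e x = {x}"
  using assms by (auto simp: closed_part_def maximal_below_def)

lemma istopology_closed_part:
  fixes e :: "'a::{complete_lattice, distrib_lattice}"
  shows "istopology (\<lambda>U. \<exists>y\<le>e. U = maximal_below e - closed_part e y)"
  unfolding istopology_def
proof (intro conjI allI impI)
  fix U V
  assume "\<exists>y\<le>e. U = maximal_below e - closed_part e y"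
    and "\<exists>y\<le>e. V = maximal_below e - closed_part e y"
  then obtain y z where "y \<le> e" "z \<le> e"
    and "U = maximal_below e - closed_part e y" "V = maximal_below e - closed_part e z"
    by blast
  then have "inf y z \<le> e" "U \<inter> V = maximal_below e - closed_part e (inf y z)"
    by (auto simp: closed_part_inf intro: le_infI1)
  then show "\<exists>y\<le>e. U \<inter> V = maximal_below e - closed_part e y"
    by blast
next
  fix \<K>
  assume "\<forall>U\<in>\<K>. \<exists>y\<le>e. U = maximal_below e - closed_part e y"
  \<comment> \<open>\<open>f\<close> chooses one \<open>y\<close> for each open set; the join of the
    choices will represent the union.\<close>
  then obtain f where f: "\<And>U. U \<in> \<K> \<Longrightarrow> f U \<le> e \<and> U = maximal_below e - closed_part e (f U)"
    by metis
  then have "Sup (f ` \<K>) \<le> e"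
    by (auto intro: SUP_least)
  moreover have "\<Union>\<K> = maximal_below e - closed_part e (Sup (f ` \<K>))"
    unfolding closed_part_Sup using f by blast
  ultimately show "\<exists>y\<le>e. \<Union>\<K> = maximal_below e - closed_part e y"
    by blast
qed

theorem lemma5p2:
  fixes e :: "'a::{ordered_comm_monoid_add, complete_lattice, distrib_lattice}"
  assumes "lsc_like TYPE('a)"
    and "least_order_unit e"
  shows "\<exists>T. topspace T = maximal_below e \<and>
    {U. openin T U} = {maximal_below e - closed_part e y | y. y \<le> e} \<and>
    t1_space T"
proof -
  define T where "T = topology (\<lambda>U. \<exists>y\<le>e. U = maximal_below e - closed_part e y)"
  have openin_T: "openin T U \<longleftrightarrow> (\<exists>y\<le>e. U = maximal_below e - closed_part e y)" for U
    by (simp add: T_def istopology_closed_part)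
  \<comment> \<open>Here \<open>y = e\<close> is the witness. All open sets lie inside this one,
    which fixes \<open>topspace T\<close>.\<close>
  have "openin T (maximal_below e)"
    unfolding openin_T using closed_part_self[of e] by blast
  then have topspace_T: "topspace T = maximal_below e"
    unfolding topspace_def openin_T by blast
  have "t1_space T"
    unfolding t1_space_def topspace_T
  proof (intro ballI impI)
    fix x y
    assume x: "x \<in> maximal_below e" and y: "y \<in> maximal_below e" and "x \<noteq> y"
    from y have "y \<le> e"
      by (simp add: maximal_below_def less_imp_le)
    \<comment> \<open>This set is the whole space without the point \<open>y\<close>, so it
      separates \<open>x\<close> from \<open>y\<close>.\<close>
    then have "openin T (maximal_below e - closed_part e y)"
      unfolding openin_T by (intro exI[of _ y] conjI refl)
    then show "\<exists>U. openin T U \<and> x \<in> U \<and> y \<notin> U"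
      using x \<open>x \<noteq> y\<close> closed_part_maximal_below[OF y] by auto
  qed
  moreover have "{U. openin T U} = {maximal_below e - closed_part e y | y. y \<le> e}"
    unfolding openin_T by auto
  ultimately show ?thesis
    using topspace_T by (intro exI[of _ T] conjI)
qed

end
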